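(* Let $G$ be a cyclic group of order $n\ge 2$ (written additively) and let $S$ be a sequence over $G$ of length $|S|=n$. If $\mathsf h(S)<4$ or $\mathsf h(S)\ge n/2$, then $S$ has a subsequence $T$ with $\operatorname{ind}(T)=1$ and length $|T|\le \mathsf h(S)$.
   Context: A sequence over $G$ is a finite unordered sequence of elements of $G$ with repetition allowed (a finite multiset); its length $|S|$ is the number of terms counted with multiplicity, a subsequence is a sub-multiset, and $\mathsf h(S)$ denotes the maximum of the multiplicities of the elements of $G$ in $S$. For a sequence $T$ over the cyclic group $G$ of order $n$ and $h\in G$ with $\operatorname{ord}(h)=n$, write $T=(n_1h)\cdot\ldots\cdot(n_lh)$ with integers $n_1,\ldots,n_l\in[1,n]$ and put $\|T\|_h=\frac{n_1+\cdots+n_l}{n}$. The index of $T$ is $\operatorname{ind}(T)=\min\{\|T\|_h : h\in G,\ \operatorname{ord}(h)=n\}$. *)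

theory Defs
  imports Complex_Main "HOL-Library.Multiset" "HOL-Algebra.Elementary_Groups"
    "HOL-Algebra.Multiplicative_Group"
begin

(* The library writes groups multiplicatively: the multiple k h of an element h
   of the cyclic group is the power of h with exponent k. A sequence over G is a
   finite multiset all of whose elements lie in the carrier of G. *)

definition max_mult :: "('a, 'b) monoid_scheme \<Rightarrow> 'a multiset \<Rightarrow> nat" where
  "max_mult G S = Max (count S ` carrier G)"

(* Well defined for G finite and h of order equal to the order of G. The range
   starts at 1, so the neutral element gets the coefficient n and not 0. *)
definition seq_coeff :: "('a, 'b) monoid_scheme \<Rightarrow> 'a \<Rightarrow> 'a \<Rightarrow> nat" where
  "seq_coeff G h g = (THE k. k \<in> {1..order G} \<and> h [^]\<^bsub>G\<^esub> k = g)"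

definition seq_norm :: "('a, 'b) monoid_scheme \<Rightarrow> 'a \<Rightarrow> 'a multiset \<Rightarrow> real" where
  "seq_norm G h T = real (\<Sum>g\<in>#T. seq_coeff G h g) / real (order G)"

definition seq_index :: "('a, 'b) monoid_scheme \<Rightarrow> 'a multiset \<Rightarrow> real" where
  "seq_index G T =
    Min {seq_norm G h T | h. h \<in> carrier G \<and> group.ord G h = order G}"

end

theory Submission
  imports Defs "HOL-Computational_Algebra.Primes"
begin

text \<open>
  A sequence has index one exactly when it is nonempty, has trivial product and, for a suitable
  generator, its coefficients add up to the group order \<open>n\<close> itself and not to a larger multiple
  of \<open>n\<close>. The two ranges of the maximal multiplicity \<open>k\<close> call for different arguments.

  For \<open>k \<le> 3\<close> the trivial product is the whole difficulty. Peel \<open>S\<close> into \<open>k\<close> layers, each of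
  them a set: first the support, then the support of what is left, and so on. If no nonempty
  subsequence of length at most \<open>k\<close> had trivial product, then each layer of size \<open>m\<close> would add, by
  Scherk's theorem on product sets (\<open>scherk\<close>), at least \<open>m\<close> new elements to the set of products
  formed with one term or no term from each layer. That makes at least \<open>n + 1\<close> products in a group
  of order \<open>n\<close>. So there is a subsequence \<open>T\<close> of length at most \<open>k\<close> with trivial product
  (\<open>short_product_one_subsequence\<close>). If \<open>T\<close> avoids the neutral element, its at most three
  coefficients are all below \<open>n\<close> and add up to \<open>n\<close> or \<open>2n\<close>; in the second case there are three of
  them, and passing to the inverse generator replaces every coefficient \<open>c\<close> by \<open>n - c\<close> and the sum
  by \<open>n\<close> (\<open>seq_index_short_product_one\<close>).

  For \<open>k \<ge> n / 2\<close> take \<open>g\<close> of multiplicity \<open>k\<close> and order \<open>d\<close>. There is a generator for which \<open>g\<close>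
  has coefficient \<open>n / d\<close> (\<open>generator_above\<close>). If \<open>d < n\<close>, then \<open>d \<le> n / 2 \<le> k\<close> copies of \<open>g\<close> have
  coefficient sum \<open>n\<close>. If \<open>d = n\<close>, then \<open>g\<close> has coefficient one, and some of the other terms,
  padded with copies of \<open>g\<close>, reach \<open>n\<close> exactly. To keep the result short, the chosen terms must save
  enough length compared with \<open>n\<close> copies of \<open>g\<close>, without overshooting \<open>n\<close>;
  \<open>sub_multiset_sum_window\<close> says that such a choice exists.
\<close>

section \<open>Sumsets and short subsequences with trivial product\<close>

text \<open>
  Scherk's bound for product sets in which the neutral element arises only trivially. The proof is
  an induction on \<open>card B\<close> by the Dyson transform: for \<open>e\<close> in \<open>A\<close>, moving from \<open>B\<close> to \<open>A\<close> the translates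
  by \<open>e\<close> that \<open>A\<close> lacks preserves \<open>card A + card B\<close> and does not enlarge the product set. The
  hypothesis on \<open>\<one>\<close> survives the move, and it also supplies an \<open>e\<close> for which \<open>B\<close> shrinks.
\<close>
lemma (in comm_group) scherk:
  assumes "finite A" "finite B" "A \<subseteq> carrier G" "B \<subseteq> carrier G" "\<one> \<in> A" "\<one> \<in> B"
    and "\<And>a b. a \<in> A \<Longrightarrow> b \<in> B \<Longrightarrow> a \<otimes> b = \<one> \<Longrightarrow> b = \<one>"
  shows "card A + card B \<le> card (A <#> B) + 1"
  using assms
proof (induction "card B" arbitrary: A B rule: less_induct)
  case less
  note fin = less.prems(1,2) and sub = less.prems(3,4) and one = less.prems(5,6)
    and unique = less.prems(7)
  show ?case
  proof (cases "B = {\<one>}")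
    case True
    have "A <#> B = A"
      using sub unfolding True set_mult_def by force
    then show ?thesis using True by simp
  next
    case False
    then obtain b where b: "b \<in> B" "b \<noteq> \<one>" using one by blast
    \<comment> \<open>Otherwise translation by \<open>b\<close> permutes the finite set \<open>A\<close>, so \<open>b\<close> has an inverse in \<open>A\<close>.\<close>
    obtain e where e: "e \<in> A" "e \<otimes> b \<notin> A"
    proof (rule ccontr)
      assume "\<not> thesis"
      then have "(\<lambda>a. a \<otimes> b) ` A \<subseteq> A" using that by blast
      moreover have "inj_on (\<lambda>a. a \<otimes> b) A"
        using sub b by (intro inj_onI) (metis right_cancel subsetD)
      ultimately have "(\<lambda>a. a \<otimes> b) ` A = A"
        using fin by (simp add: endo_inj_surj)
      with one(1) have "\<one> \<in> (\<lambda>a. a \<otimes> b) ` A" by simp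
      then show False using unique b by (auto simp: eq_commute)
    qed
    define A' where "A' = A \<union> (\<lambda>x. e \<otimes> x) ` B"
    define B' where "B' = {x \<in> B. e \<otimes> x \<in> A}"
    have ec: "e \<in> carrier G" using e sub by blast
    have "card B' < card B"
      using b e fin unfolding B'_def by (intro psubset_card_mono) auto
    moreover have "A' <#> B' \<subseteq> A <#> B"
    proof
      fix z assume "z \<in> A' <#> B'"
      then obtain x y where z: "z = x \<otimes> y" and x: "x \<in> A'" and y: "y \<in> B'"
        unfolding set_mult_def by blast
      from x consider "x \<in> A" | w where "w \<in> B" "x = e \<otimes> w" unfolding A'_def by blast
      then show "z \<in> A <#> B"
      proof cases
        case 1
        then show ?thesis using y z unfolding B'_def set_mult_def by blast
      next
        case 2
        have "z = (e \<otimes> y) \<otimes> w"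
          using 2 y z ec sub unfolding B'_def by (simp add: m_ac subset_iff)
        then show ?thesis using 2 y unfolding B'_def set_mult_def by blast
      qed
    qed
    moreover have "card A' + card B' = card A + card B"
    proof -
      let ?D = "{x \<in> B. e \<otimes> x \<notin> A}"
      have "A' = A \<union> (\<lambda>x. e \<otimes> x) ` ?D" unfolding A'_def by auto
      moreover have "card (A \<union> (\<lambda>x. e \<otimes> x) ` ?D) = card A + card ((\<lambda>x. e \<otimes> x) ` ?D)"
        using fin by (intro card_Un_disjoint) auto
      moreover have "card ((\<lambda>x. e \<otimes> x) ` ?D) = card ?D"
        using sub ec by (intro card_image inj_onI) (simp add: subset_iff)
      moreover have "card B = card (B' \<union> ?D)"
        unfolding B'_def by (rule arg_cong[where f = card]) auto
      moreover have "card (B' \<union> ?D) = card B' + card ?D"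
        using fin unfolding B'_def by (intro card_Un_disjoint) auto
      ultimately show ?thesis by simp
    qed
    moreover have "card A' + card B' \<le> card (A' <#> B') + 1"
    proof (rule less.hyps)
      show "card B' < card B" by fact
      show "finite A'" "finite B'" using fin by (auto simp: A'_def B'_def)
      show "A' \<subseteq> carrier G" "B' \<subseteq> carrier G" using sub ec by (auto simp: A'_def B'_def)
      show "\<one> \<in> A'" "\<one> \<in> B'" using one e ec by (auto simp: A'_def B'_def)
      fix x y assume x: "x \<in> A'" and y: "y \<in> B'" and xy: "x \<otimes> y = \<one>"
      from x consider "x \<in> A" | w where "w \<in> B" "x = e \<otimes> w" unfolding A'_def by blast
      then show "y = \<one>"
      proof cases
        case 1
        then show ?thesis using unique xy y unfolding B'_def by blast
      next
        case 2
        have yc: "y \<in> carrier G" "w \<in> carrier G" using y 2 sub by (auto simp: B'_def)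
        have "(e \<otimes> y) \<otimes> w = \<one>"
          using xy 2 yc ec by (simp add: m_ac)
        moreover have "e \<otimes> y \<in> A" using y by (simp add: B'_def)
        ultimately have "w = \<one>" using unique 2 by blast
        then have "e \<otimes> y = \<one>" using xy 2 ec by simp
        then show ?thesis using unique e y by (auto simp: B'_def)
      qed
    qed
    moreover have "card (A' <#> B') \<le> card (A <#> B)"
    proof (rule card_mono)
      have "A <#> B = (\<lambda>(x, y). x \<otimes> y) ` (A \<times> B)" unfolding set_mult_def by auto
      then show "finite (A <#> B)" using fin by simp
    qed fact
    ultimately show ?thesis by linarith
  qed
qed

text \<open>
  Powers indexed by the carrier, in place of a product over the terms, make concatenation
  of sequences a pointwise product. For an infinite carrier \<open>finprod\<close> may take its default value
  \<open>\<one>\<close>; finiteness is assumed where the value matters.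
\<close>
definition seq_prod :: "('a, 'b) monoid_scheme \<Rightarrow> 'a multiset \<Rightarrow> 'a" where
  "seq_prod G T = finprod G (\<lambda>g. g [^]\<^bsub>G\<^esub> count T g) (carrier G)"

lemma (in comm_group) seq_prod_empty: "seq_prod G {#} = \<one>"
  by (simp add: seq_prod_def finprod_one_eqI)

lemma (in comm_group) seq_prod_union: "seq_prod G (T + U) = seq_prod G T \<otimes> seq_prod G U"
proof -
  have "seq_prod G (T + U) = finprod G (\<lambda>g. g [^] count T g \<otimes> g [^] count U g) (carrier G)"
    unfolding seq_prod_def by (rule finprod_cong') (auto simp: nat_pow_mult)
  then show ?thesis by (simp add: seq_prod_def)
qed

lemma (in comm_group) seq_prod_single:
  assumes "finite (carrier G)" "x \<in> carrier G"
  shows "seq_prod G {#x#} = x"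
proof -
  have "seq_prod G {#x#} = finprod G (\<lambda>g. if x = g then g else \<one>) (carrier G)"
    unfolding seq_prod_def by (rule finprod_cong') auto
  then show ?thesis using finprod_singleton[of x "carrier G" "\<lambda>g. g"] assms by simp
qed

lemma (in comm_group) seq_prod_closed: "seq_prod G T \<in> carrier G"
  unfolding seq_prod_def by (rule finprod_closed) auto

text \<open>
  The layer argument, by induction on \<open>k\<close>: remove one copy of each element of the support \<open>A\<close>, so
  that all multiplicities drop to at most \<open>k\<close>, and multiply the products of length at most \<open>k\<close> of the
  rest by \<open>insert \<one> A\<close>. Since no short nonempty subsequence has trivial product, \<open>\<one>\<close> is represented
  only trivially and Scherk's bound adds \<open>card A\<close> to the count.
\<close>
lemma (in comm_group) card_short_products:
  assumes "finite (carrier G)" "set_mset S \<subseteq> carrier G" "\<And>g. count S g \<le> k"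
    and "\<And>T. T \<subseteq># S \<Longrightarrow> size T \<le> k \<Longrightarrow> seq_prod G T = \<one> \<Longrightarrow> T = {#}"
  shows "size S + 1 \<le> card (seq_prod G ` {T. T \<subseteq># S \<and> size T \<le> k})"
  using assms(2-)
proof (induction k arbitrary: S)
  case 0
  then have "S = {#}" by (simp add: multiset_eq_iff)
  moreover have "{T. T \<subseteq># {#} \<and> size T \<le> (0::nat)} = {{#}}" by auto
  ultimately show ?case by simp
next
  case (Suc k)
  define A where "A = set_mset S"
  define S' where "S' = S - mset_set A"
  have A: "finite A" "A \<subseteq> carrier G" using Suc.prems(1) by (auto simp: A_def)
  have "mset_set A \<subseteq># S" unfolding A_def
    by (auto simp: subseteq_mset_def count_mset_set' Suc_le_eq count_greater_zero_iff)
  then have S: "S = S' + mset_set A" by (simp add: S'_def)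
  have S'sub: "S' \<subseteq># S" by (simp add: S'_def)
  have snoc: "add_mset a T \<subseteq># S" if "T \<subseteq># S'" "a \<in> A" for a T
  proof -
    have "{#a#} \<subseteq># mset_set A" using that A by simp
    then have "T + {#a#} \<subseteq># S' + mset_set A" using that by (intro subset_mset.add_mono)
    then show ?thesis using S by simp
  qed
  have prod_snoc: "seq_prod G (add_mset a T) = seq_prod G T \<otimes> a" if "a \<in> A" for a T
    using seq_prod_union[of T "{#a#}"] seq_prod_single[OF assms(1)] that A by auto
  let ?P = "seq_prod G ` {T. T \<subseteq># S' \<and> size T \<le> k}"
  let ?Q = "seq_prod G ` {T. T \<subseteq># S \<and> size T \<le> Suc k}"
  have one_notin: "\<one> \<notin> A"
  proof
    assume "\<one> \<in> A"
    then show False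
      using Suc.prems(3)[of "{#\<one>#}"] seq_prod_single[OF assms(1), of \<one>] by (simp add: A_def)
  qed
  have "size S' + 1 \<le> card ?P"
  proof (rule Suc.IH)
    show "set_mset S' \<subseteq> carrier G" using Suc.prems(1) S'sub by (meson order_trans set_mset_mono)
    show "count S' g \<le> k" for g
    proof (cases "g \<in> A")
      case True
      then show ?thesis using Suc.prems(2)[of g] A by (simp add: S'_def)
    next
      case False
      then have "count S g = 0" by (simp add: A_def not_in_iff)
      then show ?thesis by (simp add: S'_def)
    qed
    show "T = {#}" if "T \<subseteq># S'" "size T \<le> k" "seq_prod G T = \<one>" for T
      using Suc.prems(3)[of T] that S'sub by (meson le_SucI subset_mset.order_trans)
  qed
  moreover have "card ?P + card (insert \<one> A) \<le> card (?P <#> insert \<one> A) + 1"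
  proof (rule scherk)
    have "?P \<subseteq> carrier G" using seq_prod_closed by auto
    then show "?P \<subseteq> carrier G" "finite ?P"
      using assms(1) finite_subset by auto
    show "finite (insert \<one> A)" "insert \<one> A \<subseteq> carrier G" using A by auto
    show "\<one> \<in> ?P" using seq_prod_empty by (intro image_eqI[of _ _ "{#}"]) auto
    show "\<one> \<in> insert \<one> A" by simp
    fix p a assume p: "p \<in> ?P" and a: "a \<in> insert \<one> A" and pa: "p \<otimes> a = \<one>"
    from p obtain T where T: "p = seq_prod G T" "T \<subseteq># S'" "size T \<le> k" by blast
    show "a = \<one>"
    proof (rule ccontr)
      assume "a \<noteq> \<one>"
      then have "a \<in> A" using a by blast
      then have "add_mset a T = {#}"
        using Suc.prems(3)[OF snoc[of T a]] prod_snoc[of a T] T pa by simp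
      then show False by simp
    qed
  qed
  moreover have "card (?P <#> insert \<one> A) \<le> card ?Q"
  proof (rule card_mono)
    have "?Q \<subseteq> carrier G" using seq_prod_closed by auto
    then show "finite ?Q" using assms(1) finite_subset by blast
    show "?P <#> insert \<one> A \<subseteq> ?Q"
    proof
      fix z assume "z \<in> ?P <#> insert \<one> A"
      then obtain T a where z: "z = seq_prod G T \<otimes> a" and a: "a \<in> insert \<one> A"
        and T: "T \<subseteq># S'" "size T \<le> k"
        unfolding set_mult_def by blast
      show "z \<in> ?Q"
      proof (cases "a \<in> A")
        case True
        then show ?thesis using z T snoc prod_snoc
          by (intro image_eqI[of _ _ "add_mset a T"]) auto
      next
        case False
        then have "z = seq_prod G T" using z a seq_prod_closed by auto
        moreover have "T \<subseteq># S" using T S'sub by (meson subset_mset.order_trans)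
        ultimately show ?thesis using T by auto
      qed
    qed
  qed
  moreover have "size S = size S' + card A" using S by (metis size_mset_set size_union)
  ultimately show ?case using one_notin A by simp
qed

text \<open>
  Without such a subsequence the short products would outnumber the elements of the group.
\<close>
lemma (in comm_group) short_product_one_subsequence:
  assumes "finite (carrier G)" "set_mset S \<subseteq> carrier G" "order G \<le> size S"
    and "\<And>g. count S g \<le> k"
  shows "\<exists>T. T \<subseteq># S \<and> T \<noteq> {#} \<and> size T \<le> k \<and> seq_prod G T = \<one>"
proof (rule ccontr)
  assume "\<not> ?thesis"
  then have "size S + 1 \<le> card (seq_prod G ` {T. T \<subseteq># S \<and> size T \<le> k})"
    using assms by (intro card_short_products) auto
  also have "\<dots> \<le> order G"
    unfolding order_def using assms(1) seq_prod_closed by (intro card_mono) auto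
  finally show False using assms(3) by simp
qed

section \<open>Coefficients and the index\<close>

lemma (in group) bij_betw_powers_generator:
  assumes "finite (carrier G)" "h \<in> carrier G" "ord h = order G"
  shows "bij_betw (\<lambda>k::nat. h [^] k) {1..order G} (carrier G)"
proof -
  have inj: "inj_on (\<lambda>k::nat. h [^] k) {1..order G}" 
    using ord_inj'[OF assms(2)] unfolding assms(3) .
  have "(\<lambda>k::nat. h [^] k) ` {1..order G} = carrier G"
  proof (rule card_subset_eq[OF assms(1)])
    show "(\<lambda>k::nat. h [^] k) ` {1..order G} \<subseteq> carrier G" using assms(2) by auto
    show "card ((\<lambda>k::nat. h [^] k) ` {1..order G}) = card (carrier G)"
      unfolding card_image[OF inj] by (simp add: order_def)
  qed
  with inj show ?thesis unfolding bij_betw_def by (rule conjI)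
qed

lemma (in group) seq_coeff_eqI:
  assumes "finite (carrier G)" "h \<in> carrier G" "ord h = order G"
    and "k \<in> {1..order G}" "h [^] k = g"
  shows "seq_coeff G h g = k"
  unfolding seq_coeff_def
proof (rule the_equality)
  show "k \<in> {1..order G} \<and> h [^] k = g" using assms(4,5) by blast
  fix l assume l: "l \<in> {1..order G} \<and> h [^] l = g"
  have "h [^] l = h [^] k" unfolding assms(5) by (rule conjunct2[OF l])
  then show "l = k"
    by (rule inj_onD[OF bij_betw_imp_inj_on[OF bij_betw_powers_generator[OF assms(1-3)]]
      _ conjunct1[OF l] assms(4)])
qed

lemma (in group) seq_coeff_generator:
  assumes "finite (carrier G)" "h \<in> carrier G" "ord h = order G" "g \<in> carrier G"
  shows "seq_coeff G h g \<in> {1..order G}" "h [^] seq_coeff G h g = g"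
proof -
  have "g \<in> (\<lambda>k::nat. h [^] k) ` {1..order G}"
    using assms(4) unfolding bij_betw_imp_surj_on[OF bij_betw_powers_generator[OF assms(1-3)]] .
  then obtain k where k: "k \<in> {1..order G}" "h [^] k = g" by blast
  show "seq_coeff G h g \<in> {1..order G}" "h [^] seq_coeff G h g = g"
    unfolding seq_coeff_eqI[OF assms(1-3) k] by (fact k)+
qed

text \<open>
  The exponents in the coefficient sum are the discrete logarithms to base \<open>h\<close>; hence divisibility
  of the sum by the group order does not depend on the generator.
\<close>
lemma (in comm_group) power_sum_seq_coeff:
  assumes "finite (carrier G)" "h \<in> carrier G" "ord h = order G" "set_mset T \<subseteq> carrier G"
  shows "h [^] (\<Sum>g\<in>#T. seq_coeff G h g) = seq_prod G T"
  using assms(4)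
proof (induction T)
  case empty
  show ?case by (simp add: seq_prod_empty)
next
  case (add x T)
  have "seq_prod G (add_mset x T) = x \<otimes> seq_prod G T"
    using seq_prod_union[of "{#x#}" T] seq_prod_single[OF assms(1), of x] add.prems by simp
  moreover have "h [^] (\<Sum>g\<in>#add_mset x T. seq_coeff G h g)
      = h [^] seq_coeff G h x \<otimes> h [^] (\<Sum>g\<in>#T. seq_coeff G h g)"
    using nat_pow_mult[OF assms(2)] by simp
  moreover have "h [^] seq_coeff G h x = x"
    using seq_coeff_generator(2)[OF assms(1-3)] add.prems by simp
  moreover have "h [^] (\<Sum>g\<in>#T. seq_coeff G h g) = seq_prod G T"
    using add by simp
  ultimately show ?case by simp
qed

lemma (in comm_group) order_dvd_sum_seq_coeff_iff:
  assumes "finite (carrier G)" "h \<in> carrier G" "ord h = order G" "set_mset T \<subseteq> carrier G"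
  shows "order G dvd (\<Sum>g\<in>#T. seq_coeff G h g) \<longleftrightarrow> seq_prod G T = \<one>"
  unfolding power_sum_seq_coeff[OF assms, symmetric] pow_eq_id[OF assms(2)] assms(3) ..

text \<open>
  One generator with coefficient sum equal to the group order forces trivial product, so for every
  other generator the sum is a positive multiple of the group order and cannot be smaller.
\<close>
lemma (in comm_group) seq_index_eq_1I:
  assumes fin: "finite (carrier G)" and h: "h \<in> carrier G" "ord h = order G"
    and T: "set_mset T \<subseteq> carrier G"
    and sum: "(\<Sum>g\<in>#T. seq_coeff G h g) = order G"
  shows "seq_index G T = 1"
proof -
  have pos: "order G > 0" using fin order_gt_0_iff_finite by blast
  have prod: "seq_prod G T = \<one>"
    using order_dvd_sum_seq_coeff_iff[OF fin h T] sum by simp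
  have "T \<noteq> {#}" using sum pos by auto
  then obtain x where x: "x \<in># T" by blast
  let ?N = "{seq_norm G k T | k. k \<in> carrier G \<and> ord k = order G}"
  have "?N = (\<lambda>k. seq_norm G k T) ` {k \<in> carrier G. ord k = order G}" by blast
  then have "finite ?N" using fin by simp
  moreover have "1 \<in> ?N"
  proof -
    have "seq_norm G h T = 1" unfolding seq_norm_def sum using pos by simp
    then show ?thesis using h by force
  qed
  moreover have "1 \<le> y" if "y \<in> ?N" for y
  proof -
    obtain k where k: "k \<in> carrier G" "ord k = order G" and y: "y = seq_norm G k T"
      using \<open>y \<in> ?N\<close> by blast
    obtain T' where T': "T = add_mset x T'" using x by (metis insert_DiffM)
    have "0 < seq_coeff G k x"
      using seq_coeff_generator(1)[OF fin k, of x] x T by auto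
    then have "0 < (\<Sum>g\<in>#T. seq_coeff G k g)" using T' by simp
    then have "order G \<le> (\<Sum>g\<in>#T. seq_coeff G k g)"
      using order_dvd_sum_seq_coeff_iff[OF fin k T] prod by (simp add: dvd_imp_le)
    then show ?thesis unfolding y seq_norm_def using pos by (simp del: of_nat_sum_mset)
  qed
  ultimately have "Min ?N = 1" using Min_eqI[of ?N 1] by blast
  then show ?thesis by (simp only: seq_index_def)
qed

text \<open>
  With all coefficients strictly between \<open>0\<close> and \<open>n\<close>, the sums for \<open>e\<close> and for \<open>inv e\<close> are positive
  multiples of \<open>n\<close> that add up to \<open>n * size T \<le> 3 * n\<close>, so one of them is \<open>n\<close>.
\<close>
lemma (in comm_group) seq_index_short_product_one:
  assumes fin: "finite (carrier G)" and e: "e \<in> carrier G" "ord e = order G"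
    and T: "set_mset T \<subseteq> carrier G" "T \<noteq> {#}" "size T \<le> 3" "seq_prod G T = \<one>"
    and one: "\<one> \<notin># T"
  shows "seq_index G T = 1"
proof -
  let ?n = "order G" and ?c = "seq_coeff G e"
  have c_bounds: "1 \<le> ?c g" "?c g < ?n" if "g \<in># T" for g
  proof -
    have g: "g \<in> carrier G" "g \<noteq> \<one>" using that T one by auto
    have "e [^] ?n = \<one>" using pow_ord_eq_1[OF e(1)] e(2) by simp
    then have "?c g \<noteq> ?n" using seq_coeff_generator(2)[OF fin e g(1)] g(2) by auto
    then show "1 \<le> ?c g" "?c g < ?n"
      using seq_coeff_generator(1)[OF fin e g(1)] by auto
  qed
  have inv_coeff: "seq_coeff G (inv e) g = ?n - ?c g" if "g \<in># T" for g
  proof (rule seq_coeff_eqI[OF fin])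
    have g: "g \<in> carrier G" using that T by auto
    show "inv e \<in> carrier G" "ord (inv e) = order G" using e by auto
    show "?n - ?c g \<in> {1..order G}" using c_bounds[OF that] by auto
    have "e [^] ?c g \<otimes> e [^] (?n - ?c g) = \<one>"
      using c_bounds[OF that] e pow_ord_eq_1[OF e(1)] by (simp add: nat_pow_mult)
    then have "inv (e [^] (?n - ?c g)) = e [^] ?c g"
      using e by (intro inv_equality) auto
    then show "inv e [^] (?n - ?c g) = g"
      using seq_coeff_generator(2)[OF fin e g] e by (simp add: nat_pow_inv)
  qed
  obtain q where q: "(\<Sum>g\<in>#T. ?c g) = ?n * q"
    using order_dvd_sum_seq_coeff_iff[OF fin e T(1)] T(4) by blast
  have sum_add: "(\<Sum>g\<in>#T. ?c g) + (\<Sum>g\<in>#T. ?n - ?c g) = ?n * size T"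
  proof -
    have "(\<Sum>g\<in>#T. ?c g) + (\<Sum>g\<in>#T. ?n - ?c g) = (\<Sum>g\<in>#T. ?c g + (?n - ?c g))"
      by (simp add: sum_mset.distrib)
    also have "\<dots> = (\<Sum>g\<in>#T. ?n)"
      using c_bounds by (intro arg_cong[where f = sum_mset] image_mset_cong) (simp add: less_imp_le)
    finally show ?thesis by (simp add: mult.commute)
  qed
  obtain x T' where T': "T = add_mset x T'" using T(2) by (metis multiset_cases)
  then have x: "x \<in># T" by simp
  have "(\<Sum>g\<in>#T. ?c g) > 0" "(\<Sum>g\<in>#T. ?n - ?c g) > 0" using c_bounds[OF x] T' by auto
  then have "0 < ?n * q" "?n * q < ?n * size T" using q sum_add by linarith+
  then have "0 < q" "q < size T" by auto
  then consider "q = 1" | "q = 2" "size T = 3" using T(3) by linarith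
  then show ?thesis
  proof cases
    case 1
    then show ?thesis using q seq_index_eq_1I[OF fin e T(1)] by simp
  next
    case 2
    have "(\<Sum>g\<in>#T. seq_coeff G (inv e) g) = (\<Sum>g\<in>#T. ?n - ?c g)"
      using inv_coeff by (intro arg_cong[where f = sum_mset] image_mset_cong)
    also have "\<dots> = ?n" using sum_add q 2 by simp
    finally show ?thesis using e by (intro seq_index_eq_1I[OF fin _ _ T(1), of "inv e"]) auto
  qed
qed

lemma (in group) seq_coeff_one:
  assumes "finite (carrier G)" "e \<in> carrier G" "ord e = order G"
  shows "seq_coeff G e \<one> = order G"
proof (rule seq_coeff_eqI[OF assms])
  have "order G > 0" using assms(1) order_gt_0_iff_finite by blast
  then show "order G \<in> {1..order G}" by simp
  show "e [^] order G = \<one>" using pow_ord_eq_1[OF assms(2)] assms(3) by simp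
qed

section \<open>An element of large multiplicity\<close>

text \<open>
  The reduction from units modulo \<open>n\<close> to units modulo a divisor \<open>d\<close> is surjective. The lift is
  \<open>a + d * t\<close>, where \<open>t\<close> collects the primes of \<open>n\<close> that do not divide \<open>a\<close>: each prime of \<open>n\<close> then
  divides exactly one of the two summands.
\<close>
lemma coprime_lift:
  fixes a d n :: nat
  assumes "d dvd n" "n > 0" "coprime a d"
  shows "\<exists>u. coprime u n \<and> u mod d = a mod d"
proof -
  define t where "t = \<Prod>{p. prime p \<and> p dvd n \<and> \<not> p dvd a}"
  have fin: "finite {p. prime p \<and> p dvd n \<and> \<not> p dvd a}"
    using finite_divisors_nat[OF assms(2)] by (rule rev_finite_subset) blast
  have "coprime (a + d * t) n"
  proof (rule ccontr)
    assume "\<not> coprime (a + d * t) n"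
    then have "gcd (a + d * t) n \<noteq> 1" by (simp add: coprime_iff_gcd_eq_1)
    then obtain p where p: "prime p" "p dvd a + d * t" "p dvd n"
      using assms(2) prime_divisor_exists[of "gcd (a + d * t) n"] by auto
    show False
    proof (cases "p dvd a")
      case True
      then have "p dvd d * t" using p(2) by (simp add: dvd_add_right_iff)
      moreover have "\<not> p dvd d"
        using True assms(3) p(1) by (meson coprime_common_divisor not_prime_unit)
      ultimately have "p dvd t" using p(1) prime_dvd_mult_iff by blast
      then obtain q where "prime q" "\<not> q dvd a" "p dvd q"
        using prime_dvd_prod_iff[OF fin p(1), of "\<lambda>x. x"] unfolding t_def by auto
      then show False using True p(1) primes_dvd_imp_eq by blast
    next
      case False
      then have "p dvd t" using p fin unfolding t_def by (auto intro: dvd_prodI)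
      then show False using False p(2) by (simp add: dvd_add_left_iff)
    qed
  qed
  moreover have "(a + d * t) mod d = a mod d" by simp
  ultimately show ?thesis by blast
qed

text \<open>
  Write \<open>g\<close> as a power of \<open>e\<close> with exponent \<open>m * a\<close>, where \<open>m = n div ord g\<close>. The cofactor \<open>a\<close> is a
  unit modulo \<open>ord g\<close> and matters only modulo \<open>ord g\<close>, so it may be replaced by a unit \<open>u\<close> modulo \<open>n\<close>;
  the generator sought is the power of \<open>e\<close> with exponent \<open>u\<close>.
\<close>
lemma (in group) generator_above:
  assumes fin: "finite (carrier G)" and e: "e \<in> carrier G" "ord e = order G"
    and g: "g \<in> carrier G"
  shows "\<exists>h \<in> carrier G. ord h = order G \<and> h [^] (order G div ord g) = g"
proof -
  let ?n = "order G" and ?d = "ord g"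
  have n: "?n > 0" using fin order_gt_0_iff_finite by blast
  have dn: "?d dvd ?n" using g by (rule ord_dvd_group_order)
  then obtain m where nm: "?n = ?d * m" by blast
  have d: "?d > 0" and m: "m > 0" using n nm by auto
  obtain k where k: "k \<in> {1..?n}" "e [^] k = g"
    using seq_coeff_generator[OF fin e g] by blast
  have "?d = ?n div gcd ?n k" using ord_pow_gen[OF e(1), of k] k e(2) by auto
  then have "?d * gcd ?n k = ?d * m" using nm by (metis dvd_div_mult_self gcd_dvd1)
  then have gcd: "gcd ?n k = m" using d by simp
  then obtain a where ka: "k = m * a" by (metis gcd_dvd2 dvdE)
  have "m * gcd ?d a = m * 1"
    using gcd unfolding nm ka by (simp add: gcd_mult_distrib_nat mult.commute)
  then have "coprime a ?d" using m by (simp add: coprime_iff_gcd_eq_1 gcd.commute)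
  then obtain u where u: "coprime u ?n" "u mod ?d = a mod ?d"
    using coprime_lift[OF dn n] by blast
  have "(u * m) mod ?n = k mod ?n"
    using u(2) unfolding nm ka by (metis mult.commute mult_mod_right)
  moreover have "e [^] x = e [^] (x mod ?n)" for x :: nat
  proof -
    have "e [^] (?n * (x div ?n) + x mod ?n) = (e [^] ?n) [^] (x div ?n) \<otimes> e [^] (x mod ?n)"
      using e(1) by (simp add: nat_pow_mult nat_pow_pow)
    then show ?thesis using e pow_ord_eq_1[OF e(1)] by simp
  qed
  ultimately have "e [^] (u * m) = g" using k(2) by metis
  then have "(e [^] u) [^] m = g" using e(1) by (simp add: nat_pow_pow)
  moreover have "ord (e [^] u) = ?n" using pow_ord_eq_ord_iff[OF fin e(1)] u(1) e(2) by simp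
  moreover have "?n div ?d = m" using nm d by simp
  ultimately show ?thesis using e(1) by auto
qed

text \<open>
  Here \<open>w x\<close> will be the coefficient of \<open>x\<close> minus one, that is, the length saved by using \<open>x\<close> in place
  of as many copies of the frequent element. All of \<open>R\<close> saves at least \<open>size R\<close>; choose a smallest \<open>U\<close>
  that still does. Dropping the lightest element \<open>x\<close> of \<open>U\<close> brings the sum below \<open>size R\<close>, and since
  every other element weighs at least \<open>w x\<close>, the product of \<open>w x\<close> and \<open>size U - 1\<close> is below \<open>size R\<close>
  as well. Positive integers satisfy \<open>a + b \<le> a * b + 1\<close>, so \<open>w x + size U\<close> is at most \<open>size R + 1\<close>,
  and \<open>U\<close> stays within \<open>2 * size R\<close>. This takes \<open>U\<close> to have two terms or more; a single term is within
  bounds because \<open>w x < n\<close>.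
\<close>
lemma sub_multiset_sum_window:
  fixes w :: "'a \<Rightarrow> nat"
  assumes w: "\<And>x. x \<in># R \<Longrightarrow> 1 \<le> w x \<and> w x < n" and R: "2 * size R \<le> n"
  shows "\<exists>U. U \<subseteq># R \<and> size R \<le> (\<Sum>x\<in>#U. w x) \<and> (\<Sum>x\<in>#U. w x) + size U \<le> n"
proof -
  let ?m = "size R"
  let ?P = "\<lambda>U. U \<subseteq># R \<and> ?m \<le> (\<Sum>x\<in>#U. w x)"
  have "(\<Sum>x\<in>#R. 1) \<le> (\<Sum>x\<in>#R. w x)" using w by (intro sum_mset_mono) auto
  then have "?P R" by simp
  then obtain U where U: "?P U" and min: "\<And>V. ?P V \<Longrightarrow> size U \<le> size V"
    using ex_has_least_nat[of ?P R size] by blast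
  have "(\<Sum>x\<in>#U. w x) + size U \<le> n"
  proof (cases "U = {#}")
    case False
    then have ne: "w ` set_mset U \<noteq> {}" by simp
    have "Min (w ` set_mset U) \<in> w ` set_mset U" using ne by (intro Min_in) auto
    then obtain x where x: "x \<in># U" "w x = Min (w ` set_mset U)" by auto
    define V where "V = U - {#x#}"
    have UV: "U = add_mset x V" using x by (simp add: V_def)
    have xR: "1 \<le> w x" "w x < n" using w[of x] U x(1) by (auto dest: mset_subset_eqD)
    have "V \<subseteq># R" using U by (metis UV mset_subset_eq_insertD subset_mset.less_imp_le)
    then have sV: "(\<Sum>x\<in>#V. w x) < ?m" using min[of V] UV by force
    show ?thesis
    proof (cases "V = {#}")
      case True
      then show ?thesis using UV xR by simp
    next
      case False
      then obtain b where b: "size V = Suc b" by (metis size_eq_0_iff_empty not0_implies_Suc)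
      obtain a where a: "w x = Suc a" using xR by (cases "w x") auto
      have "(\<Sum>y\<in>#V. w x) \<le> (\<Sum>y\<in>#V. w y)"
        unfolding x(2) UV by (intro sum_mset_mono Min_le) auto
      then have "Suc b * Suc a \<le> (\<Sum>y\<in>#V. w y)" using a b by simp
      \<comment> \<open>Successors turn \<open>a + b \<le> a * b + 1\<close> into an expansion of the product.\<close>
      then have "w x + size V \<le> (\<Sum>y\<in>#V. w y) + 1" using a b by simp
      then show ?thesis using sV R UV by simp
    qed
  qed (use U in simp)
  then show ?thesis using U by blast
qed

section \<open>Subsequences of index one\<close>

text \<open>
  When \<open>g\<close> generates, the padded sequence consists of \<open>U\<close> and \<open>n - c\<close> copies of \<open>g\<close>, where \<open>c\<close> is the
  coefficient sum of \<open>U\<close>. Its length is \<open>n\<close> minus the saving of \<open>U\<close>, and a saving of at least the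
  number of terms other than \<open>g\<close> brings it down to the multiplicity of \<open>g\<close>. The same bound
  shows that enough copies of \<open>g\<close> are available.
\<close>
lemma (in comm_group) index_one_subsequence_high_multiplicity:
  assumes fin: "finite (carrier G)" and e: "e \<in> carrier G" "ord e = order G"
    and S: "set_mset S \<subseteq> carrier G" "size S = order G"
    and g: "g \<in> carrier G" and mult: "order G \<le> 2 * count S g"
  shows "\<exists>T. T \<subseteq># S \<and> seq_index G T = 1 \<and> size T \<le> count S g"
proof -
  let ?n = "order G" and ?d = "ord g" and ?h = "count S g"
  have n: "?n > 0" using fin order_gt_0_iff_finite by blast
  obtain m where nm: "?n = ?d * m" using ord_dvd_group_order[OF g] by blast
  have d: "?d > 0" "m > 0" using n nm by auto
  obtain h where h: "h \<in> carrier G" "ord h = ?n" and hg: "h [^] m = g"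
    using generator_above[OF fin e g] nm d by auto
  have cg: "seq_coeff G h g = m"
    using nm d hg by (intro seq_coeff_eqI[OF fin h]) auto
  show ?thesis
  proof (cases "m = 1")
    case False
    then have "?d * 2 \<le> ?d * m" using d by (intro mult_le_mono2) simp
    then have "?d \<le> ?h" using nm mult by linarith
    moreover have "seq_index G (replicate_mset ?d g) = 1"
      using g cg nm by (intro seq_index_eq_1I[OF fin h]) auto
    ultimately show ?thesis
      by (intro exI[of _ "replicate_mset ?d g"]) (simp add: count_le_replicate_mset_subset_eq)
  next
    case True
    define R where "R = filter_mset (\<lambda>x. x \<noteq> g) S"
    have SR: "S = R + replicate_mset ?h g"
      unfolding R_def by (rule multiset_eqI) auto
    then have sizeR: "size R + ?h = ?n" using S(2) by (metis size_replicate_mset size_union)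
    let ?c = "seq_coeff G h"
    have c: "2 \<le> ?c x \<and> ?c x \<le> ?n" if "x \<in># R" for x
    proof -
      have x: "x \<in> carrier G" "x \<noteq> g" using that S(1) by (auto simp: R_def)
      then have "?c x \<noteq> 1"
        using seq_coeff_generator(2)[OF fin h x(1)] hg True by (metis)
      then show ?thesis using seq_coeff_generator(1)[OF fin h x(1)] by auto
    qed
    have "\<exists>U. U \<subseteq># R \<and> size R \<le> (\<Sum>x\<in>#U. ?c x - 1) \<and> (\<Sum>x\<in>#U. ?c x - 1) + size U \<le> ?n"
    proof (rule sub_multiset_sum_window)
      show "1 \<le> ?c x - 1 \<and> ?c x - 1 < ?n" if "x \<in># R" for x using c[OF that] by auto
      show "2 * size R \<le> ?n" using sizeR mult by linarith
    qed
    then obtain U where U: "U \<subseteq># R" "size R \<le> (\<Sum>x\<in>#U. ?c x - 1)"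
      "(\<Sum>x\<in>#U. ?c x - 1) + size U \<le> ?n" by blast
    have "(\<Sum>x\<in>#U. ?c x - 1) + size U = (\<Sum>x\<in>#U. (?c x - 1) + 1)"
      by (simp only: sum_mset.distrib) simp
    also have "\<dots> = (\<Sum>x\<in>#U. ?c x)"
      using c U(1) by (intro arg_cong[where f = sum_mset] image_mset_cong)
        (fastforce dest: mset_subset_eqD)
    finally have sumU: "(\<Sum>x\<in>#U. ?c x - 1) + size U = (\<Sum>x\<in>#U. ?c x)" .
    define r where "r = ?n - (\<Sum>x\<in>#U. ?c x)"
    define T where "T = U + replicate_mset r g"
    have size: "size T \<le> ?h" using U sumU sizeR by (simp add: T_def r_def)
    have "replicate_mset r g \<subseteq># replicate_mset ?h g"
      using size by (simp add: T_def count_le_replicate_mset_subset_eq[symmetric])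
    then have TS: "T \<subseteq># S" unfolding T_def by (subst SR) (intro subset_mset.add_mono U)
    have "(\<Sum>x\<in>#T. ?c x) = ?n" using U(3) sumU cg True by (simp add: T_def r_def)
    then have "seq_index G T = 1"
      using TS S(1) by (intro seq_index_eq_1I[OF fin h]) (auto dest: mset_subset_eqD)
    then show ?thesis using size TS by blast
  qed
qed

text \<open>
  The neutral element is split off because its coefficient is \<open>n\<close>: it has index one by itself, whereas
  a longer sequence containing it has coefficient sum above \<open>n\<close> for every generator.
\<close>
lemma (in comm_group) index_one_subsequence_low_multiplicity:
  assumes fin: "finite (carrier G)" and e: "e \<in> carrier G" "ord e = order G"
    and S: "set_mset S \<subseteq> carrier G" "order G \<le> size S"
    and k: "\<And>g. count S g \<le> k" "k \<le> 3"
  shows "\<exists>T. T \<subseteq># S \<and> seq_index G T = 1 \<and> size T \<le> k"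
proof -
  obtain T where T: "T \<subseteq># S" "T \<noteq> {#}" "size T \<le> k" "seq_prod G T = \<one>"
    using short_product_one_subsequence[OF fin S k(1)] by blast
  show ?thesis
  proof (cases "\<one> \<in># T")
    case True
    then have "{#\<one>#} \<subseteq># S" "1 \<le> size T"
      using T(1) by (auto dest: mset_subset_eqD simp: Suc_le_eq nonempty_has_size[symmetric])
    moreover have "seq_index G {#\<one>#} = 1"
      using seq_coeff_one[OF fin e] by (intro seq_index_eq_1I[OF fin e]) auto
    ultimately show ?thesis using T(3) by (intro exI[of _ "{#\<one>#}"]) simp
  next
    case False
    then have "seq_index G T = 1"
      using T S(1) k(2) by (intro seq_index_short_product_one[OF fin e]) (auto dest: mset_subset_eqD)
    then show ?thesis using T by blast
  qed
qed

theorem theorem1p3: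
  fixes G :: "('a, 'b) monoid_scheme" and n :: nat and S :: "'a multiset"
  assumes "group G" and "cyclic_group G" and "order G = n" and "n \<ge> 2"
    and "set_mset S \<subseteq> carrier G" and "size S = n"
    and "max_mult G S < 4 \<or> real (max_mult G S) \<ge> real n / 2"
  shows "\<exists>T. T \<subseteq># S \<and> seq_index G T = 1 \<and> size T \<le> max_mult G S"
proof -
  interpret comm_group G using assms(1,2) by (simp add: group.cyclic_imp_abelian_group)
  have fin: "finite (carrier G)" using assms(3,4) order_gt_0_iff_finite by force
  obtain e where e: "e \<in> carrier G" "ord e = order G"
    using assms(2) cyclic_order_is_ord unfolding cyclic_group_def by metis
  have img: "finite (count S ` carrier G)" "count S ` carrier G \<noteq> {}" using fin by auto
  from assms(7) show ?thesis
  proof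
    assume small: "max_mult G S < 4"
    have "count S g \<le> max_mult G S" for g
    proof (cases "g \<in> carrier G")
      case True
      then show ?thesis using img unfolding max_mult_def by (intro Max_ge) auto
    next
      case False
      then have "count S g = 0" using assms(5) by (auto simp: count_eq_zero_iff)
      then show ?thesis by simp
    qed
    then show ?thesis
      using small assms(3,5,6) by (intro index_one_subsequence_low_multiplicity[OF fin e]) auto
  next
    assume large: "real (max_mult G S) \<ge> real n / 2"
    have "max_mult G S \<in> count S ` carrier G"
      unfolding max_mult_def using img by (rule Max_in)
    then obtain g where g: "g \<in> carrier G" "count S g = max_mult G S" by auto
    then show ?thesis
      using index_one_subsequence_high_multiplicity[OF fin e assms(5) _ g(1)] large assms(3,6)
      by simp
  qed
qed

end
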